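(* Let $\mathcal{X}\subseteq\mathbb{R}^n$ be nonempty and compact with $P:=\operatorname{conv}(\mathcal{X})$ a polytope, let $B\in\mathbb{R}^{n\times r}$ and $P_B=B^{\mathsf T}P$. Let $\mathcal{D}\subset\mathbb{R}^n\setminus\{0\}$ be a finite set that covers the edge directions of $P$. Let $L$, $d=\dim L$, the central hyperplane arrangement $\mathcal{H}_B(\mathcal{D})$ in $L$, and $N=|\mathcal{H}_B(\mathcal{D})|$ be as defined in the context. Choose one direction $z_C$ from every full-dimensional chamber $C$ of $L\setminus\bigcup\mathcal{H}_B(\mathcal{D})$, and for each $C$ choose $$x_C\in\operatorname*{Arg\,max}_{x\in\mathcal{X}}\langle z_C,B^{\mathsf T}x\rangle .$$ Then $\{B^{\mathsf T}x_C\}_C$ contains every vertex of $P_B$. Consequently, the number of vertices of $P_B$ satisfies $$|\operatorname{vert}(P_B)|\le R_{\mathrm c}(N,d):=\begin{cases}1,& d=0\text{ or }N=0,\\ 2\sum_{j=0}^{d-1}\binom{N-1}{j},& d\ge1,\ N\ge1.\end{cases}$$ For fixed $d\ge1$, the bound $R_{\mathrm c}(N,d)$ is $O(N^{d-1})$.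
   Context: A finite set $\mathcal{D}\subset\mathbb{R}^n\setminus\{0\}$ covers the edge directions of $P$ if every edge vector $v-u$ of $P$ (for $[u,v]$ an edge of $P$) is a nonzero scalar multiple of some element of $\mathcal{D}$. Let $L:=\operatorname{lin}(P_B-P_B)\subseteq\mathbb{R}^r$ be the linear span of differences of points of $P_B$, and $d:=\dim L$. For $d_0\in\mathcal{D}$ let $g(d_0):=\operatorname{proj}_L(B^{\mathsf T}d_0)$, with $\operatorname{proj}_L$ the orthogonal projection onto $L$. Discard the $d_0$ with $g(d_0)=0$, identify nonzero scalar multiples, and set $\mathcal{H}_B(\mathcal{D}):=\{H_g: g=g(d_0)\ne0,\ d_0\in\mathcal{D}\}$, where $H_g:=\{z\in L:\langle z,g\rangle=0\}$; $N$ is the number of distinct hyperplanes. Chambers are the connected components of $L\setminus\bigcup\mathcal{H}_B(\mathcal{D})$. $\operatorname{vert}(P_B)$ is the vertex set of $P_B$; its cardinality is called the scattering number of $(P,B)$. *)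

theory Defs
  imports "HOL-Analysis.Analysis" "HOL-Library.Landau_Symbols"
begin

definition vertices :: "'a::real_vector set \<Rightarrow> 'a set" where
  "vertices S = {v. v extreme_point_of S}"

definition covers_edge_directions :: "'a::euclidean_space set \<Rightarrow> 'a set \<Rightarrow> bool" where
  "covers_edge_directions D P \<longleftrightarrow>
     (\<forall>u v. closed_segment u v edge_of P \<longrightarrow> (\<exists>d\<in>D. \<exists>c. c \<noteq> 0 \<and> v - u = c *\<^sub>R d))"

definition proj_image :: "real^'r^'n \<Rightarrow> (real^'n) set \<Rightarrow> (real^'r) set" where
  "proj_image B P = (\<lambda>x. transpose B *v x) ` P"

definition diff_span :: "'a::real_vector set \<Rightarrow> 'a set" where
  "diff_span S = span {x - y | x y. x \<in> S \<and> y \<in> S}"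

text \<open>Orthogonal projection; only meaningful when \<open>L\<close> is a subspace.\<close>

definition orth_proj :: "'a::euclidean_space set \<Rightarrow> 'a \<Rightarrow> 'a" where
  "orth_proj L x = (THE y. y \<in> L \<and> (\<forall>w\<in>L. orthogonal (x - y) w))"

lemma orth_proj_ex1:
  fixes x :: "'a::euclidean_space"
  assumes "subspace L"
  shows "\<exists>!y. y \<in> L \<and> (\<forall>w\<in>L. orthogonal (x - y) w)"
proof -
  obtain y z where y: "y \<in> span L" and z: "\<And>w. w \<in> span L \<Longrightarrow> orthogonal z w"
    and x: "x = y + z"
    using orthogonal_subspace_decomp_exists by metis
  have L: "span L = L" using assms by (simp add: span_eq_iff)
  show ?thesis
  proof (rule ex1I[of _ y])
    show "y \<in> L \<and> (\<forall>w\<in>L. orthogonal (x - y) w)"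
      using y z x L by auto
  next
    fix y' assume y': "y' \<in> L \<and> (\<forall>w\<in>L. orthogonal (x - y') w)"
    have m: "y' - y \<in> L" using y' y L assms by (simp add: subspace_diff)
    have "orthogonal (x - y') (y' - y)" "orthogonal (x - y) (y' - y)"
      using y' z m x L by auto
    then have "(y' - y) \<bullet> (y' - y) = 0"
      by (simp add: orthogonal_def inner_diff_left)
    then show "y' = y" by simp
  qed
qed

lemma orth_proj:
  assumes "subspace L"
  shows "orth_proj L x \<in> L" and "w \<in> L \<Longrightarrow> orthogonal (x - orth_proj L x) w"
  using theI'[OF orth_proj_ex1[OF assms, of x]] unfolding orth_proj_def by auto

text \<open>
  Directions whose projections are nonzero multiples of each other give the same
  hyperplane, so forming the set of hyperplanes performs the identification of
  proportional normals.
\<close>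

definition hyperplane_arrangement ::
    "real^'r^'n \<Rightarrow> (real^'r) set \<Rightarrow> (real^'n) set \<Rightarrow> (real^'r) set set" where
  "hyperplane_arrangement B L D =
     {{z \<in> L. z \<bullet> g = 0} | g. g \<in> (\<lambda>d. orth_proj L (transpose B *v d)) ` D \<and> g \<noteq> 0}"

definition chambers :: "'a::euclidean_space set \<Rightarrow> 'a set set \<Rightarrow> 'a set set" where
  "chambers L H = components (L - \<Union>H)"

definition full_dim_chambers :: "'a::euclidean_space set \<Rightarrow> 'a set set \<Rightarrow> 'a set set" where
  "full_dim_chambers L H = {C \<in> chambers L H. aff_dim C = int (dim L)}"

definition Rc :: "nat \<Rightarrow> nat \<Rightarrow> nat" where
  "Rc N d = (if d = 0 \<or> N = 0 then 1 else 2 * (\<Sum>j=0..d - 1. (N - 1) choose j))"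

end

theory Submission imports Defs begin

text \<open>
  If \<open>z\<close> lies in \<open>L\<close> off the arrangement, the face of \<open>P\<close> maximising \<open>B z\<close> projects to a single point:
  otherwise that face would have an edge with nonzero image, whose direction gives an element \<open>d\<close> of
  \<open>D\<close> with \<open>B\<^sup>T d \<in> L - {0}\<close> orthogonal to \<open>z\<close>. Hence \<open>P\<^sub>B\<close> has a unique maximiser in every such
  direction, it is a vertex, and it is locally constant in \<open>z\<close>, so constant on each chamber. The
  directions in \<open>L\<close> exposing a given vertex are relatively open and therefore meet the complement of
  finitely many hyperplanes, so every vertex arises from some chamber. For the bound, distinct
  vertices have exposing directions with distinct sign patterns against normals of the arrangement,
  and sign patterns are counted by deletion and restriction.
\<close>

section \<open>Edges of a polytope along which a functional varies\<close>

text \<open>In a smallest counterexample of dimension at least two, the functional is constant on each facet,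
  hence on the connected relative frontier, which contains all extreme points.\<close>

lemma polytope_edge_inner_neq:
  fixes K :: "'a::euclidean_space set"
  assumes "polytope K" "x \<in> K" "y \<in> K" "a \<bullet> x \<noteq> a \<bullet> y"
  shows "\<exists>u w. closed_segment u w edge_of K \<and> a \<bullet> u \<noteq> a \<bullet> w"
  using assms
proof (induction "nat (aff_dim K)" arbitrary: K x y rule: less_induct)
  case less
  have cK: "convex K" "compact K" "polyhedron K"
    using less.prems(1) by (auto intro: polytope_imp_convex polytope_imp_compact polytope_imp_polyhedron)
  have "aff_dim {x, y} \<le> aff_dim K"
    using less.prems by (intro aff_dim_subset) auto
  moreover have "x \<noteq> y" using less.prems by auto
  ultimately have ge1: "1 \<le> aff_dim K" by (simp add: aff_dim_2)
  show ?case
  proof (cases "aff_dim K = 1")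
    case True
    obtain u w where uw: "K = closed_segment u w"
      using compact_convex_collinear_segment cK True less.prems(2) collinear_aff_dim
      by (metis empty_iff order_refl)
    have "a \<bullet> u \<noteq> a \<bullet> w"
    proof
      assume "a \<bullet> u = a \<bullet> w"
      then have "{u, w} \<subseteq> {z. a \<bullet> z = a \<bullet> u}" by auto
      then have "K \<subseteq> {z. a \<bullet> z = a \<bullet> u}"
        unfolding uw segment_convex_hull by (rule hull_minimal) (rule convex_hyperplane)
      then have "a \<bullet> x = a \<bullet> u" "a \<bullet> y = a \<bullet> u" using less.prems(2,3) by blast+
      then show False using less.prems(4) by simp
    qed
    then show ?thesis
      using True cK(1) uw by (metis edge_of_def face_of_refl)
  next
    case False
    show ?thesis
    proof (rule ccontr)
      assume no: "\<not> ?thesis"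
      have const: "a \<bullet> p = a \<bullet> q" if F: "F facet_of K" and pq: "p \<in> F" "q \<in> F" for F p q
      proof (rule ccontr)
        assume neq: "a \<bullet> p \<noteq> a \<bullet> q"
        have FK: "F face_of K" using F by (rule facet_of_imp_face_of)
        have "nat (aff_dim F) < nat (aff_dim K)"
          using F ge1 unfolding facet_of_def by auto
        then obtain u w where "closed_segment u w edge_of F" "a \<bullet> u \<noteq> a \<bullet> w"
          using less.hyps[OF _ face_of_polytope_polytope[OF less.prems(1) FK] pq neq] by blast
        then show False using no FK by (meson edge_of_def face_of_trans)
      qed
      have rf: "rel_frontier K = \<Union>{F. F facet_of K}"
        by (rule rel_frontier_of_polyhedron[OF cK(3)])
      \<comment> \<open>Each of the finitely many facets contributes at most one value, and a
        continuous function with finite range on a connected set is constant. Dimension one had to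
        be split off because there the relative frontier is two points.\<close>
      have "finite ((\<bullet>) a ` rel_frontier K)"
      proof -
        have fin: "finite {F. F facet_of K}"
          using finite_polytope_faces[OF less.prems(1)]
          by (rule finite_subset[rotated]) (auto simp: facet_of_imp_face_of)
        have "finite ((\<bullet>) a ` F)" if "F facet_of K" for F
        proof (cases "F = {}")
          case False
          then obtain p where "p \<in> F" by auto
          then have "(\<bullet>) a ` F \<subseteq> {a \<bullet> p}" using const[OF that] by blast
          then show ?thesis using finite_subset by blast
        qed auto
        then show ?thesis using fin unfolding rf image_Union by auto
      qed
      moreover have "connected (rel_frontier K)"
        using False cK by (intro connected_sphere_gen) (auto simp: compact_imp_bounded)
      ultimately have "(\<bullet>) a constant_on rel_frontier K"
        by (intro continuous_finite_range_constant) (auto intro!: continuous_intros)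
      then obtain c where c: "\<And>p. p \<in> rel_frontier K \<Longrightarrow> a \<bullet> p = c"
        unfolding constant_on_def by auto
      have "p \<in> rel_frontier K" if p: "p extreme_point_of K" for p
      proof -
        have "K \<noteq> {p}" using \<open>x \<noteq> y\<close> less.prems by auto
        then show ?thesis
          using face_of_subset_rel_frontier[of "{p}" K] p by (simp add: face_of_singleton)
      qed
      then have "{p. p extreme_point_of K} \<subseteq> {p. a \<bullet> p = c}" using c by auto
      then have "convex hull {p. p extreme_point_of K} \<subseteq> {p. a \<bullet> p = c}"
        by (rule hull_minimal) (rule convex_hyperplane)
      then have "K \<subseteq> {p. a \<bullet> p = c}"
        using Krein_Milman_Minkowski[OF cK(2,1)] by simp
      then have "a \<bullet> x = c" "a \<bullet> y = c" using less.prems(2,3) by blast+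
      then show False using less.prems(4) by simp
    qed
  qed
qed

section \<open>Unique maximisers of linear functionals\<close>

text \<open>For a polytope \<open>Q\<close> and a point \<open>v\<close> of it, the directions
  \<open>z\<close> satisfying this form the interior of the normal cone of \<open>Q\<close> at
  \<open>v\<close>.\<close>

definition strict_max_at :: "'a::real_inner set \<Rightarrow> 'a \<Rightarrow> 'a \<Rightarrow> bool" where
  "strict_max_at Q z v \<longleftrightarrow> v \<in> Q \<and> (\<forall>q\<in>Q. q \<noteq> v \<longrightarrow> z \<bullet> q < z \<bullet> v)"

lemma strict_max_at_unique:
  "strict_max_at Q z v \<Longrightarrow> strict_max_at Q z w \<Longrightarrow> v = w"
  unfolding strict_max_at_def by (metis less_asym)

lemma strict_max_at_imp_vertex:
  assumes "strict_max_at Q z v"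
  shows "v \<in> vertices Q"
proof -
  have eq: "Q \<inter> {x. z \<bullet> x = z \<bullet> v} = {v}"
    using assms unfolding strict_max_at_def by fastforce
  have "v extreme_point_of Q"
    by (rule extreme_point_of_Int_supporting_hyperplane_le[OF eq])
      (use assms in \<open>auto simp: strict_max_at_def intro: less_imp_le\<close>)
  then show ?thesis by (simp add: vertices_def)
qed

text \<open>Every face of a polyhedron is exposed; a supporting inequality that is tight only at
  \<open>v\<close> provides the direction.\<close>

lemma vertex_strict_max_at:
  fixes Q :: "'a::euclidean_space set"
  assumes "polytope Q" "v \<in> vertices Q"
  shows "\<exists>z. strict_max_at Q z v"
proof -
  have v: "{v} face_of Q"
    using assms by (simp add: vertices_def face_of_singleton)
  then have "{v} exposed_face_of Q"
    using assms exposed_face_of_polyhedron polytope_imp_polyhedron by blast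
  then obtain a b where ab: "Q \<subseteq> {x. a \<bullet> x \<le> b}" "{v} = Q \<inter> {x. a \<bullet> x = b}"
    unfolding exposed_face_of_def by auto
  then have "strict_max_at Q a v"
    unfolding strict_max_at_def
  proof (intro conjI ballI impI)
    have v': "v \<in> Q" "a \<bullet> v = b" using ab(2) by auto
    show "v \<in> Q" by (fact v'(1))
    fix q assume q: "q \<in> Q" "q \<noteq> v"
    then have "a \<bullet> q \<le> b" "a \<bullet> q \<noteq> b" using ab by auto
    then show "a \<bullet> q < a \<bullet> v" using v' by simp
  qed
  then show ?thesis ..
qed

lemma finite_vertices_polytope:
  fixes Q :: "'a::euclidean_space set"
  assumes "polytope Q"
  shows "finite (vertices Q)"
proof -
  have "(\<lambda>v. {v}) ` vertices Q \<subseteq> {F. F face_of Q}"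
    by (auto simp: vertices_def face_of_singleton)
  then have "finite ((\<lambda>v. {v}) ` vertices Q)"
    using finite_polytope_faces[OF assms] finite_subset by blast
  then show ?thesis by (rule finite_imageD) auto
qed

text \<open>Only finitely many vertices compete with \<open>v\<close>, and beating each of them is
  an open condition. Within \<open>S\<close> a unique maximiser exists and is a vertex, so once
  \<open>v\<close> beats all other vertices it must be that maximiser.\<close>

lemma strict_max_at_locally_constant:
  fixes Q :: "'a::euclidean_space set"
  assumes "polytope Q" "\<And>z. z \<in> S \<Longrightarrow> \<exists>v. strict_max_at Q z v" "strict_max_at Q z v"
  shows "\<exists>U. open U \<and> z \<in> U \<and> (\<forall>z'\<in>U \<inter> S. strict_max_at Q z' v)"
proof -
  let ?U = "\<Inter>w\<in>vertices Q - {v}. {y. y \<bullet> w < y \<bullet> v}"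
  have sub: "vertices Q \<subseteq> Q" by (auto simp: vertices_def extreme_point_of_def)
  have "open ?U"
    using finite_vertices_polytope[OF assms(1)]
    by (intro open_INT ballI open_Collect_less) (auto intro!: continuous_intros)
  moreover have "z \<in> ?U"
    using assms(3) sub by (auto simp: strict_max_at_def)
  moreover have "strict_max_at Q z' v" if z': "z' \<in> ?U \<inter> S" for z'
  proof -
    obtain w where w: "strict_max_at Q z' w" using assms(2) z' by blast
    have "w = v"
    proof (rule ccontr)
      assume "w \<noteq> v"
      then have "z' \<bullet> w < z' \<bullet> v" using z' strict_max_at_imp_vertex[OF w] by auto
      moreover have "z' \<bullet> v < z' \<bullet> w"
        using w \<open>w \<noteq> v\<close> assms(3) by (auto simp: strict_max_at_def)
      ultimately show False by simp
    qed
    with w show ?thesis by simp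
  qed
  ultimately show ?thesis by blast
qed

text \<open>Sending a point of \<open>S\<close> to its maximiser is a locally constant map, hence
  constant on a connected set.\<close>

lemma strict_max_at_connected:
  fixes Q :: "'a::euclidean_space set"
  assumes "polytope Q" "connected S" "\<And>z. z \<in> S \<Longrightarrow> \<exists>v. strict_max_at Q z v"
    and "z \<in> S" "z' \<in> S" "strict_max_at Q z v"
  shows "strict_max_at Q z' v"
proof -
  define m where "m = (\<lambda>y. THE w. strict_max_at Q y w)"
  have m_eq: "m y = w" if "strict_max_at Q y w" for y w
    unfolding m_def using that strict_max_at_unique by (blast intro: the_equality)
  have "m z = m z'"
  proof (rule connected_local_const[OF assms(2,4,5)], intro ballI)
    fix y assume "y \<in> S"
    then obtain w where w: "strict_max_at Q y w" using assms(3) by blast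
    obtain U where U: "open U" "y \<in> U" "\<And>y'. y' \<in> U \<inter> S \<Longrightarrow> strict_max_at Q y' w"
      using strict_max_at_locally_constant[OF assms(1,3) w, of S] by blast
    then show "\<forall>\<^sub>F y' in at y within S. m y = m y'"
      unfolding eventually_at_topological using m_eq w by (metis IntI)
  qed
  then show ?thesis
    using m_eq assms(3,5,6) by metis
qed

text \<open>From a point orthogonal to \<open>g\<close>, a small move along \<open>g\<close> leaves
  the hyperplane and stays in \<open>L\<close>, since \<open>g\<close> itself lies in
  \<open>L\<close>. Shrinking \<open>U\<close> to its part off this hyperplane preserves the gain
  when the induction hypothesis is applied to \<open>G\<close>.\<close>

lemma open_avoid_hyperplanes:
  fixes L :: "'a::real_inner set"
  assumes "finite G" "subspace L" "G \<subseteq> L" "0 \<notin> G" "open U" "z \<in> U \<inter> L"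
  shows "\<exists>z'\<in>U \<inter> L. \<forall>g\<in>G. z' \<bullet> g \<noteq> 0"
  using assms
proof (induction G arbitrary: U z rule: finite_induct)
  case empty
  then show ?case by auto
next
  case (insert g G)
  have "\<exists>z'\<in>U \<inter> L. z' \<bullet> g \<noteq> 0"
  proof (cases "z \<bullet> g = 0")
    case True
    have "((\<lambda>t. z + t *\<^sub>R g) \<longlongrightarrow> z + 0 *\<^sub>R g) (at_right (0::real))"
      by (intro tendsto_intros)
    then have "\<forall>\<^sub>F t in at_right (0::real). z + t *\<^sub>R g \<in> U"
      by (rule topological_tendstoD) (use insert.prems in auto)
    moreover have "\<forall>\<^sub>F t in at_right (0::real). t > 0"
      by (rule eventually_at_right_less)
    ultimately have "\<forall>\<^sub>F t in at_right (0::real). z + t *\<^sub>R g \<in> U \<and> t > 0"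
      by eventually_elim simp
    then obtain t where t: "z + t *\<^sub>R g \<in> U" "t > 0"
      using eventually_happens trivial_limit_at_right_real by blast
    have "z + t *\<^sub>R g \<in> L"
      using insert.prems by (auto intro: subspace_add subspace_scale)
    moreover have "(z + t *\<^sub>R g) \<bullet> g \<noteq> 0"
      using True t insert.prems by (auto simp: inner_add_left)
    ultimately show ?thesis using t by blast
  qed (use insert.prems in auto)
  then obtain y where y: "y \<in> U \<inter> L" "y \<bullet> g \<noteq> 0" by blast
  have "open (U \<inter> {x. x \<bullet> g \<noteq> 0})"
    using insert.prems by (intro open_Int open_Collect_neq) (auto intro!: continuous_intros)
  then have "\<exists>z'\<in>(U \<inter> {x. x \<bullet> g \<noteq> 0}) \<inter> L. \<forall>h\<in>G. z' \<bullet> h \<noteq> 0"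
    using insert.prems y by (intro insert.IH[of _ y]) auto
  then show ?case by auto
qed

section \<open>Counting sign patterns by deletion and restriction\<close>

text \<open>A sign vector is encoded by its positive part, which loses nothing because zero signs
  are excluded. The patterns correspond to the regions into which the hyperplanes with normals in
  \<open>G\<close> cut \<open>L\<close>.\<close>

definition sign_patterns :: "'a::real_inner set \<Rightarrow> 'a set \<Rightarrow> 'a set set" where
  "sign_patterns L G = {{g \<in> G. 0 < z \<bullet> g} | z. z \<in> L \<and> (\<forall>g\<in>G. z \<bullet> g \<noteq> 0)}"

lemma sign_patterns_subset_Pow: "sign_patterns L G \<subseteq> Pow G"
  by (auto simp: sign_patterns_def)

lemma sign_patterns_insert:
  assumes "A \<in> sign_patterns L (insert h G)" "h \<notin> G"
  shows "A - {h} \<in> sign_patterns L G"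
proof -
  obtain z where z: "A = {g \<in> insert h G. 0 < z \<bullet> g}" "z \<in> L" "\<forall>g\<in>insert h G. z \<bullet> g \<noteq> 0"
    using assms(1) by (auto simp: sign_patterns_def)
  have "A - {h} = {g \<in> G. 0 < z \<bullet> g}" using z(1) assms(2) by auto
  then show ?thesis using z by (auto simp: sign_patterns_def)
qed

text \<open>As in Cover's function-counting theorem, inserting \<open>h\<close> splits exactly those sign patterns that are
  already realised on the hyperplane orthogonal to \<open>h\<close>.\<close>

lemma sign_patterns_insert_both:
  assumes L: "subspace L" and "h \<notin> G"
    and A: "A \<in> sign_patterns L (insert h G)" "h \<notin> A" "insert h A \<in> sign_patterns L (insert h G)"
  shows "A \<in> sign_patterns (L \<inter> {z. z \<bullet> h = 0}) G"
proof -
  obtain y where y: "A = {g \<in> insert h G. 0 < y \<bullet> g}" "y \<in> L" "\<forall>g\<in>insert h G. y \<bullet> g \<noteq> 0"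
    using A(1) unfolding sign_patterns_def by blast
  obtain z where z: "insert h A = {g \<in> insert h G. 0 < z \<bullet> g}" "z \<in> L" "\<forall>g\<in>insert h G. z \<bullet> g \<noteq> 0"
    using A(3) unfolding sign_patterns_def by blast
  have yh: "y \<bullet> h < 0" and zh: "0 < z \<bullet> h"
    using y z A(2) by (auto simp: set_eq_iff not_less_iff_gr_or_eq)
  have same: "0 < y \<bullet> g \<longleftrightarrow> 0 < z \<bullet> g" if "g \<in> G" for g
    using y(1) z(1) that assms(2) by (auto simp: set_eq_iff)
  \<comment> \<open>the point where the segment from \<open>y\<close> to \<open>z\<close> meets the hyperplane, up to a positive factor\<close>
  define x where "x = (z \<bullet> h) *\<^sub>R y + (- (y \<bullet> h)) *\<^sub>R z"
  have xL: "x \<in> L" unfolding x_def using L y z by (intro subspace_add subspace_scale) auto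
  have xh: "x \<bullet> h = 0" by (simp add: x_def inner_add_left inner_diff_left)
  have xg: "x \<bullet> g \<noteq> 0 \<and> (0 < x \<bullet> g \<longleftrightarrow> g \<in> A)" if g: "g \<in> G" for g
  proof (cases "0 < y \<bullet> g")
    case True
    then have "0 < (z \<bullet> h) * (y \<bullet> g) + (- (y \<bullet> h)) * (z \<bullet> g)"
      using same[OF g] yh zh by (intro add_pos_pos mult_pos_pos) auto
    then have "0 < x \<bullet> g" unfolding x_def inner_add_left inner_scaleR_left .
    moreover have "g \<in> A" using y(1) True g by auto
    ultimately show ?thesis by auto
  next
    case False
    then have "y \<bullet> g < 0" "z \<bullet> g < 0"
      using same[OF g] y(3) z(3) g by (auto simp: not_less_iff_gr_or_eq)
    then have "(z \<bullet> h) * (y \<bullet> g) + (- (y \<bullet> h)) * (z \<bullet> g) < 0"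
      using yh zh by (intro add_neg_neg mult_pos_neg) auto
    then have "x \<bullet> g < 0" unfolding x_def inner_add_left inner_scaleR_left .
    moreover have "g \<notin> A" using y(1) False by auto
    ultimately show ?thesis by auto
  qed
  have "A = {g \<in> G. 0 < x \<bullet> g}"
    using xg y(1) A(2) by auto
  then show ?thesis
    using xL xh xg unfolding sign_patterns_def by blast
qed

text \<open>\<open>F0\<close> and \<open>F1\<close> are the patterns without and with
  \<open>h\<close>, the latter after deleting \<open>h\<close>. Their union consists of patterns for
  \<open>G\<close>, their intersection of patterns realised on the hyperplane orthogonal to
  \<open>h\<close>, and the cardinalities of union and intersection add up to those of
  \<open>F0\<close> and \<open>F1\<close>.\<close>

lemma card_sign_patterns_insert:
  assumes L: "subspace L" and G: "finite G" "h \<notin> G"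
  shows "card (sign_patterns L (insert h G))
    \<le> card (sign_patterns L G) + card (sign_patterns (L \<inter> {z. z \<bullet> h = 0}) G)"
proof -
  let ?F = "sign_patterns L (insert h G)"
  define F0 where "F0 = {A \<in> ?F. h \<notin> A}"
  define F1 where "F1 = (\<lambda>A. A - {h}) ` {A \<in> ?F. h \<in> A}"
  have finp: "finite (sign_patterns M G')" if "finite G'" for M G'
    using sign_patterns_subset_Pow that finite_subset by (metis finite_Pow_iff)
  have fin: "finite ?F" "finite F0" "finite F1"
    using finp[of "insert h G" L] G by (auto simp: F0_def F1_def)
  have inj: "inj_on (\<lambda>A. A - {h}) {A \<in> ?F. h \<in> A}"
    by (rule inj_onI) auto
  have "?F = F0 \<union> {A \<in> ?F. h \<in> A}" by (auto simp: F0_def)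
  then have "card ?F = card F0 + card {A \<in> ?F. h \<in> A}"
    using fin by (metis (no_types, lifting) F0_def card_Un_disjoint disjoint_iff finite_Un mem_Collect_eq)
  also have "\<dots> = card F0 + card F1"
    using card_image[OF inj] by (simp add: F1_def)
  also have "\<dots> = card (F0 \<union> F1) + card (F0 \<inter> F1)"
    by (rule card_Un_Int) (use fin in auto)
  also have "\<dots> \<le> card (sign_patterns L G) + card (sign_patterns (L \<inter> {z. z \<bullet> h = 0}) G)"
  proof (intro add_mono card_mono finp G)
    show "F0 \<union> F1 \<subseteq> sign_patterns L G"
      using sign_patterns_insert[OF _ G(2)] by (fastforce simp: F0_def F1_def)
    show "F0 \<inter> F1 \<subseteq> sign_patterns (L \<inter> {z. z \<bullet> h = 0}) G"
      unfolding F0_def F1_def using sign_patterns_insert_both[OF L G(2)]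
      by (auto simp: insert_absorb)
  qed
  finally show ?thesis .
qed

text \<open>Pascal's rule, summed. The two sums on the right are the deletion and restriction terms
  of the recursion.\<close>

lemma sum_binomial_Suc:
  "(\<Sum>j<Suc d. Suc n choose j) = (\<Sum>j<Suc d. n choose j) + (\<Sum>j<d. n choose j)"
  by (subst (1 2) sum.lessThan_Suc_shift) (simp add: sum.distrib)

text \<open>Induction on \<open>G\<close> with \<open>L\<close> and \<open>d\<close> varying, since
  restriction lowers the dimension. As \<open>d\<close> is only an upper bound for
  \<open>dim L\<close>, the restricted space can use \<open>d - 1\<close> whatever its exact
  dimension.\<close>

lemma card_sign_patterns_le:
  fixes L :: "'a::euclidean_space set"
  assumes "finite G" "subspace L" "dim L \<le> d"
  shows "card (sign_patterns L G)
    \<le> (if G = {} then 1 else 2 * (\<Sum>j<d. (card G - 1) choose j))"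
  using assms
proof (induction G arbitrary: L d rule: finite_induct)
  case empty
  have "sign_patterns L {} \<subseteq> {{}}" by (auto simp: sign_patterns_def)
  then show ?case using card_mono[of "{{}}" "sign_patterns L {}"] by simp
next
  case (insert h G)
  show ?case
  proof (cases "\<forall>z\<in>L. z \<bullet> h = 0")
    case True
    \<comment> \<open>Every \<open>z\<close> in \<open>L\<close> is orthogonal to \<open>h\<close>,
      so none is admissible. This case absorbs \<open>d = 0\<close>, where the claimed bound is an
      empty sum.\<close>
    then have "sign_patterns L (insert h G) = {}" unfolding sign_patterns_def by blast
    then show ?thesis by simp
  next
    case False
    let ?L' = "L \<inter> {z. z \<bullet> h = 0}"
    have sub': "subspace ?L'"
      using insert.prems(1) subspace_hyperplane[of h]
      by (intro subspace_inter) (simp_all add: inner_commute)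
    have "?L' \<subset> L" using False by auto
    then have "dim ?L' < dim L"
      using sub' insert.prems(1) by (metis dim_psubset span_eq_iff)
    then obtain d' where d': "d = Suc d'" "dim ?L' \<le> d'"
      using insert.prems(2) by (cases d) auto
    note step = card_sign_patterns_insert[OF insert.prems(1) insert.hyps]
    note IH = insert.IH[OF insert.prems] insert.IH[OF sub' d'(2)]
    show ?thesis
    proof (cases "G = {}")
      case True
      \<comment> \<open>Both terms of the recursion are at most 1, and the summand
        \<open>j = 0\<close> already makes the right-hand side at least 2.\<close>
      then have "(1::nat) \<le> (\<Sum>j<d. 0 choose j)"
        unfolding d'(1) by (subst sum.lessThan_Suc_shift) simp
      then show ?thesis using step IH True by simp
    next
      case False
      then obtain n where n: "card G = Suc n"
        using insert.hyps(1) by (metis card_eq_0_iff not0_implies_Suc)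
      have "card (sign_patterns L (insert h G))
          \<le> 2 * ((\<Sum>j<Suc d'. n choose j) + (\<Sum>j<d'. n choose j))"
        using step IH False n d'(1) by simp
      also have "\<dots> = 2 * (\<Sum>j<Suc d'. Suc n choose j)" by (simp only: sum_binomial_Suc)
      finally show ?thesis using n insert.hyps d'(1) by simp
    qed
  qed
qed

lemma card_sign_patterns_le_Rc:
  fixes L :: "'a::euclidean_space set"
  assumes "finite G" "subspace L"
  shows "card (sign_patterns L G) \<le> Rc (card G) (dim L)"
proof -
  \<comment> \<open>Truncated subtraction makes this false at \<open>n = 0\<close>, so dimension
    zero is treated separately; there \<open>Rc\<close> is 1.\<close>
  have *: "{..<n} = {0..n - 1}" if "n \<noteq> 0" for n :: nat using that by auto
  show ?thesis
  proof (cases "G = {} \<or> dim L = 0")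
    case True
    then have "card (sign_patterns L G) \<le> 1"
      using card_sign_patterns_le[OF assms order_refl] by (auto simp del: dim_eq_0 split: if_splits)
    then show ?thesis using True by (auto simp: Rc_def simp del: dim_eq_0)
  next
    case False
    then show ?thesis
      using card_sign_patterns_le[OF assms order_refl] assms(1) * by (simp add: Rc_def)
  qed
qed

text \<open>For \<open>m\<close> at least 1, each of the \<open>k\<close> summands is at most
  \<open>m ^ (k - 1)\<close>, which gives the constant \<open>2 * k\<close>.\<close>

lemma Rc_bigo:
  assumes "1 \<le> k"
  shows "(\<lambda>m. real (Rc m k)) \<in> O(\<lambda>m. real m ^ (k - 1))"
proof (rule bigoI[of _ "2 * real k"])
  have "Rc m k \<le> 2 * k * m ^ (k - 1)" if "1 \<le> m" for m
  proof -
    have "(m - 1) choose j \<le> m ^ (k - 1)" if "j \<in> {0..k - 1}" for j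
    proof -
      have "(m - 1) choose j \<le> ((m - 1) choose j) * fact j" by simp
      also have "\<dots> \<le> (m - 1) ^ j" by (rule binomial_fact_pow)
      also have "\<dots> \<le> m ^ j" by (rule power_mono) auto
      also have "\<dots> \<le> m ^ (k - 1)" using that \<open>1 \<le> m\<close> by (intro power_increasing) auto
      finally show ?thesis .
    qed
    then have "(\<Sum>j=0..k - 1. (m - 1) choose j) \<le> card {0..k - 1} * m ^ (k - 1)"
      using sum_bounded_above[of "{0..k - 1}" "\<lambda>j. (m - 1) choose j"] by simp
    then show ?thesis using assms that by (simp add: Rc_def)
  qed
  then have "\<forall>\<^sub>F m in sequentially. Rc m k \<le> 2 * k * m ^ (k - 1)"
    using eventually_sequentially by blast
  then show "\<forall>\<^sub>F m in sequentially. norm (real (Rc m k)) \<le> 2 * real k * norm (real m ^ (k - 1))"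
  proof eventually_elim
    case (elim m)
    then have "real (Rc m k) \<le> real (2 * k * m ^ (k - 1))" by (rule of_nat_mono)
    then show ?case by simp
  qed
qed

section \<open>The projected polytope and its edge directions\<close>

lemma subspace_diff_span: "subspace (diff_span S)"
  unfolding diff_span_def by (rule subspace_span)

lemma diff_in_diff_span: "x \<in> S \<Longrightarrow> y \<in> S \<Longrightarrow> x - y \<in> diff_span S"
  unfolding diff_span_def by (intro span_base) blast

lemma orth_proj_eq_self:
  assumes "subspace L" "x \<in> L"
  shows "orth_proj L x = x"
  unfolding orth_proj_def
  by (rule the1_equality[OF orth_proj_ex1[OF assms(1)]]) (use assms(2) in \<open>simp add: orthogonal_def\<close>)

text \<open>Adjointness: maximising \<open>z\<close> over the projected polytope amounts to
  maximising \<open>B *v z\<close> over the original one.\<close>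

lemma inner_transpose_vector:
  fixes B :: "real^'r^'n"
  shows "z \<bullet> (transpose B *v x) = (B *v z) \<bullet> x"
  unfolding transpose_matrix_vector inner_commute[of z] dot_lmul_matrix by (rule inner_commute)

text \<open>Being a maximiser depends only on the values of \<open>z\<close> on differences of
  points of \<open>Q\<close>. These lie in \<open>diff_span Q\<close>, so an exposing direction may
  be replaced by its orthogonal projection.\<close>

lemma vertex_strict_max_at_diff_span:
  fixes Q :: "'a::euclidean_space set"
  assumes "polytope Q" "v \<in> vertices Q"
  shows "\<exists>z\<in>diff_span Q. strict_max_at Q z v"
proof -
  let ?L = "diff_span Q"
  obtain z where z: "strict_max_at Q z v"
    using vertex_strict_max_at[OF assms] by blast
  note proj = orth_proj[OF subspace_diff_span, where x = z]
  have "orth_proj ?L z \<bullet> (v - q) = z \<bullet> (v - q)" if "q \<in> Q" for q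
    using proj(2)[OF diff_in_diff_span, of v Q q] that z
    by (simp add: strict_max_at_def orthogonal_def inner_diff_left)
  then have "strict_max_at Q (orth_proj ?L z) v"
    using z by (force simp: strict_max_at_def inner_diff_right)
  then show ?thesis using proj(1) by blast
qed

lemma strict_max_at_off_arrangement:
  fixes B :: "real^'r^'n"
  defines "T \<equiv> (\<lambda>x. transpose B *v x)"
  assumes P: "polytope P" "P \<noteq> {}" and cov: "covers_edge_directions D P"
    and L: "L = diff_span (proj_image B P)"
    and z: "z \<in> L" "z \<notin> \<Union>(hyperplane_arrangement B L D)"
  shows "\<exists>v. strict_max_at (proj_image B P) z v"
proof -
  have Q: "proj_image B P = T ` P" by (simp add: proj_image_def T_def)
  have inner_T: "y \<bullet> T x = (B *v y) \<bullet> x" for x y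
    unfolding T_def by (rule inner_transpose_vector)
  have "compact P" using P by (simp add: polytope_imp_compact)
  moreover have "continuous_on P ((\<bullet>) (B *v z))"
    by (intro continuous_on_inner continuous_on_const continuous_on_id)
  ultimately obtain m where m: "m \<in> P" "\<And>x. x \<in> P \<Longrightarrow> (B *v z) \<bullet> x \<le> (B *v z) \<bullet> m"
    using continuous_attains_sup[OF _ P(2), of "(\<bullet>) (B *v z)"]
    by blast
  define K where "K = P \<inter> {x. (B *v z) \<bullet> x = (B *v z) \<bullet> m}"
  have face: "K face_of P"
    unfolding K_def
    by (rule face_of_Int_supporting_hyperplane_le) (use P m polytope_imp_convex in auto)
  have "T y = T m" if y: "y \<in> K" for y
  proof (rule ccontr)
    assume neq: "T y \<noteq> T m"
    \<comment> \<open>Chosen so that the inner product of \<open>?a\<close> with \<open>p\<close>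
      equals that of \<open>T y - T m\<close> with \<open>T p\<close>. An edge on which
      \<open>?a\<close> varies therefore has endpoints with distinct images under
      \<open>T\<close>.\<close>
    let ?a = "B *v (T y - T m)"
    have "?a \<bullet> y - ?a \<bullet> m = (T y - T m) \<bullet> (T y - T m)"
      unfolding inner_T[symmetric] by (simp add: inner_diff_right)
    then have "?a \<bullet> y \<noteq> ?a \<bullet> m" using neq by auto
    moreover have "m \<in> K" using m by (simp add: K_def)
    ultimately obtain u w where uw: "closed_segment u w edge_of K" "?a \<bullet> u \<noteq> ?a \<bullet> w"
      using polytope_edge_inner_neq[OF face_of_polytope_polytope[OF P(1) face] y] by blast
    have "closed_segment u w edge_of P"
      using uw(1) face by (meson edge_of_def face_of_trans)
    then obtain d c where d: "d \<in> D" "c \<noteq> 0" "w - u = c *\<^sub>R d"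
      using cov unfolding covers_edge_directions_def by blast
    have uwK: "u \<in> K" "w \<in> K"
      using uw(1) edge_of_imp_subset ends_in_segment by blast+
    then have uwP: "u \<in> P" "w \<in> P" by (auto simp: K_def)
    have Tdiff: "T w - T u = c *\<^sub>R T d"
      unfolding T_def matrix_vector_mult_diff_distrib[symmetric] d(3)
      by (rule matrix_vector_mult_scaleR)
    have "T w \<noteq> T u" using uw(2) unfolding inner_T[symmetric] by auto
    then have "T d \<noteq> 0" using Tdiff by auto
    \<comment> \<open>The edge maps to a difference of points of the projected polytope. Hence
      \<open>T d\<close> lies in \<open>L\<close>, is its own projection, and is one of the normals
      of the arrangement.\<close>
    have "T w - T u \<in> L"
      unfolding L Q using uwP by (intro diff_in_diff_span) auto
    then have "(1 / c) *\<^sub>R (T w - T u) \<in> L"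
      unfolding L by (intro subspace_scale subspace_diff_span)
    then have "T d \<in> L" using Tdiff d(2) by simp
    then have proj: "orth_proj L (T d) = T d"
      unfolding L by (rule orth_proj_eq_self[OF subspace_diff_span])
    \<comment> \<open>Both ends of the edge lie in \<open>K\<close>, on which \<open>B *v z\<close>
      is constant.\<close>
    have "z \<bullet> (T w - T u) = 0"
      using uwK by (simp add: K_def inner_diff_right inner_T)
    then have "z \<bullet> T d = 0" using Tdiff d(2) by simp
    then have "z \<in> {y \<in> L. y \<bullet> T d = 0}" using z(1) by simp
    moreover have "{y \<in> L. y \<bullet> T d = 0} \<in> hyperplane_arrangement B L D"
      unfolding hyperplane_arrangement_def using d(1) proj \<open>T d \<noteq> 0\<close>
      by (auto simp: T_def image_iff intro!: exI[of _ "T d"] bexI[of _ d])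
    ultimately show False using z(2) by blast
  qed
  then have "(B *v z) \<bullet> x < (B *v z) \<bullet> m" if "x \<in> P" "T x \<noteq> T m" for x
    using m(2)[OF that(1)] that by (force simp: K_def less_le)
  then have "strict_max_at (T ` P) z (T m)"
    using m(1) by (auto simp: strict_max_at_def inner_T)
  then show ?thesis unfolding Q by blast
qed

section \<open>Normals, chambers and the vertex count\<close>

text \<open>Different elements of \<open>D\<close> may give proportional normals, so one normal is
  chosen per hyperplane; the count of normals is then the count of hyperplanes.\<close>

lemma arrangement_normals:
  fixes B :: "real^'r^'n"
  assumes "finite D" "subspace L"
  defines "H \<equiv> hyperplane_arrangement B L D"
  obtains G where "finite G" "G \<subseteq> L" "0 \<notin> G" "card G = card H"
    "H = (\<lambda>g. {z \<in> L. z \<bullet> g = 0}) ` G"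
proof -
  define \<eta> where "\<eta> = (\<lambda>g. {z \<in> L. z \<bullet> g = 0})"
  define G0 where "G0 = (\<lambda>d. orth_proj L (transpose B *v d)) ` D - {0}"
  have H: "H = \<eta> ` G0"
    by (auto simp: H_def hyperplane_arrangement_def G0_def \<eta>_def)
  then obtain G where G: "G \<subseteq> G0" "H = \<eta> ` G" "inj_on \<eta> G"
    by (metis subset_image_inj order_refl)
  show ?thesis
  proof (rule that[of G])
    show "finite G" using G(1) assms(1) by (auto simp: G0_def intro: finite_subset)
    show "G \<subseteq> L" using G(1) orth_proj(1)[OF assms(2)] by (auto simp: G0_def)
    show "0 \<notin> G" using G(1) by (auto simp: G0_def)
    show "card G = card H" using G by (simp add: card_image)
    show "H = (\<lambda>g. {z \<in> L. z \<bullet> g = 0}) ` G" using G(2) by (simp add: \<eta>_def)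
  qed
qed

text \<open>The complement of finitely many closed sets is open in \<open>L\<close>, and
  \<open>L\<close> is locally connected. The component is thus relatively open and has the dimension
  of \<open>L\<close>.\<close>

lemma connected_component_in_full_dim_chambers:
  fixes L :: "'a::euclidean_space set"
  assumes "subspace L" "finite H" "\<And>h. h \<in> H \<Longrightarrow> closed h" "z \<in> L - \<Union>H"
  shows "connected_component_set (L - \<Union>H) z \<in> full_dim_chambers L H"
proof -
  let ?C = "connected_component_set (L - \<Union>H) z"
  have "open (- \<Union>H)" using assms by (auto intro: closed_Union)
  then have "openin (top_of_set L) (L - \<Union>H)"
    by (simp add: Diff_eq openin_open_Int)
  then have C: "openin (top_of_set L) ?C"
    using assms(1,4) convex_imp_locally_connected subspace_imp_convex
      locally_connected_open_connected_component by blast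
  have "z \<in> ?C" using connected_component_refl[OF assms(4)] by simp
  then have ne: "?C \<noteq> {}" by blast
  have "aff_dim ?C = int (dim L)"
    using aff_dim_openin[OF C subspace_imp_affine[OF assms(1)] ne] aff_dim_subspace[OF assms(1)] by simp
  then show ?thesis
    using componentsI[OF assms(4)] by (simp add: full_dim_chambers_def chambers_def)
qed

text \<open>Points of \<open>S\<close> with the same signs on \<open>G\<close> form a convex set, on
  which the maximiser cannot change. Choosing an exposing direction for each point of
  \<open>V\<close> therefore maps \<open>V\<close> injectively into the sign patterns.\<close>

lemma card_strict_max_points_le:
  fixes Q :: "'a::euclidean_space set"
  assumes Q: "polytope Q" and L: "subspace L" and G: "finite G"
    and S: "S = {z \<in> L. \<forall>g\<in>G. z \<bullet> g \<noteq> 0}"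
    and ex: "\<And>z. z \<in> S \<Longrightarrow> \<exists>v. strict_max_at Q z v"
    and V: "\<And>v. v \<in> V \<Longrightarrow> \<exists>z\<in>S. strict_max_at Q z v"
  shows "card V \<le> Rc (card G) (dim L)"
proof -
  obtain \<zeta> where \<zeta>: "\<And>v. v \<in> V \<Longrightarrow> \<zeta> v \<in> S \<and> strict_max_at Q (\<zeta> v) v"
    using V by metis
  define \<pi> where "\<pi> = (\<lambda>v. {g \<in> G. 0 < \<zeta> v \<bullet> g})"
  have "inj_on \<pi> V"
  proof (rule inj_onI)
    fix v w assume vw: "v \<in> V" "w \<in> V" and "\<pi> v = \<pi> w"
    then have same: "0 < \<zeta> v \<bullet> g \<longleftrightarrow> 0 < \<zeta> w \<bullet> g" if "g \<in> G" for g
      using that by (auto simp: \<pi>_def set_eq_iff)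
    define R where "R = L \<inter> (\<Inter>g\<in>G. if 0 < \<zeta> v \<bullet> g then {z. g \<bullet> z > 0} else {z. g \<bullet> z < 0})"
    have "convex R"
      unfolding R_def using L
      by (intro convex_Int convex_INT) (auto simp: subspace_imp_convex convex_halfspace_lt convex_halfspace_gt)
    moreover have memR: "z \<in> R \<longleftrightarrow> z \<in> S \<and> (\<forall>g\<in>G. 0 < z \<bullet> g \<longleftrightarrow> 0 < \<zeta> v \<bullet> g)" for z
    proof -
      have "z \<in> (if 0 < \<zeta> v \<bullet> g then {z. g \<bullet> z > 0} else {z. g \<bullet> z < 0}) \<longleftrightarrow>
          z \<bullet> g \<noteq> 0 \<and> (0 < z \<bullet> g \<longleftrightarrow> 0 < \<zeta> v \<bullet> g)" for g
        by (auto simp: inner_commute[of g])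
      then show ?thesis unfolding R_def S by blast
    qed
    moreover have "\<zeta> v \<in> R" "\<zeta> w \<in> R"
      using \<zeta>[OF vw(1)] \<zeta>[OF vw(2)] same by (simp_all add: memR)
    ultimately have "strict_max_at Q (\<zeta> w) v"
      using strict_max_at_connected[OF Q convex_connected, of R "\<zeta> v" "\<zeta> w" v] ex \<zeta>[OF vw(1)] by blast
    then show "v = w" using \<zeta>[OF vw(2)] strict_max_at_unique by blast
  qed
  moreover have "\<pi> ` V \<subseteq> sign_patterns L G"
    using \<zeta> by (auto simp: \<pi>_def sign_patterns_def S)
  moreover have "finite (sign_patterns L G)"
    using sign_patterns_subset_Pow G by (metis finite_Pow_iff finite_subset)
  ultimately have "card V \<le> card (sign_patterns L G)"
    by (rule card_inj_on_le)
  also have "\<dots> \<le> Rc (card G) (dim L)"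
    by (rule card_sign_patterns_le_Rc[OF G L])
  finally show ?thesis .
qed

theorem theorem4p2:
  fixes X :: "(real^'n) set" and B :: "real^'r^'n" and D :: "(real^'n) set"
  defines "P \<equiv> convex hull X"
  defines "PB \<equiv> proj_image B P"
  defines "L \<equiv> diff_span PB"
  defines "d \<equiv> dim L"
  defines "H \<equiv> hyperplane_arrangement B L D"
  defines "N \<equiv> card H"
  assumes "X \<noteq> {}" and "compact X" and "polytope P"
    and "finite D" and "0 \<notin> D" and "covers_edge_directions D P"
  shows "(\<forall>z x. (\<forall>C \<in> full_dim_chambers L H.
                    z C \<in> C \<and> is_arg_max (\<lambda>y. z C \<bullet> (transpose B *v y)) (\<lambda>y. y \<in> X) (x C))
            \<longrightarrow> vertices PB \<subseteq> (\<lambda>C. transpose B *v x C) ` full_dim_chambers L H)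
       \<and> finite (vertices PB) \<and> card (vertices PB) \<le> Rc N d
       \<and> (\<forall>k\<ge>1. (\<lambda>m. real (Rc m k)) \<in> O(\<lambda>m. real m ^ (k - 1)))"
proof -
  have PB: "polytope PB"
    unfolding PB_def proj_image_def using \<open>polytope P\<close>
    by (intro polytope_linear_image matrix_vector_mul_linear)
  have L: "subspace L" unfolding L_def by (rule subspace_diff_span)
  obtain G where G: "finite G" "G \<subseteq> L" "0 \<notin> G" "card G = N" "H = (\<lambda>g. {z \<in> L. z \<bullet> g = 0}) ` G"
    by (rule arrangement_normals[OF \<open>finite D\<close> L, of B, folded H_def, folded N_def])
  let ?S = "L - \<Union>H"
  have S: "?S = {z \<in> L. \<forall>g\<in>G. z \<bullet> g \<noteq> 0}" unfolding G(5) by blast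
  have "P \<noteq> {}" using \<open>X \<noteq> {}\<close> by (simp add: P_def)
  then have ex: "\<exists>v. strict_max_at PB z v" if "z \<in> ?S" for z
    using strict_max_at_off_arrangement[OF \<open>polytope P\<close> _ \<open>covers_edge_directions D P\<close>, of L B z] that
    by (simp add: PB_def L_def H_def)
  \<comment> \<open>An exposing direction in \<open>L\<close> may lie on some hyperplane; a small
    perturbation inside \<open>L\<close> avoids all of them and still exposes
    \<open>v\<close>.\<close>
  have exposed: "\<exists>z\<in>?S. strict_max_at PB z v" if v: "v \<in> vertices PB" for v
  proof -
    obtain z where z: "z \<in> L" "strict_max_at PB z v"
      using vertex_strict_max_at_diff_span[OF PB v] by (auto simp: L_def)
    obtain U where U: "open U" "z \<in> U" "\<And>z'. z' \<in> U \<inter> ?S \<Longrightarrow> strict_max_at PB z' v"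
      using strict_max_at_locally_constant[OF PB ex z(2), of ?S] by blast
    obtain z' where "z' \<in> U \<inter> L" "\<forall>g\<in>G. z' \<bullet> g \<noteq> 0"
      using open_avoid_hyperplanes[OF G(1) L G(2,3) U(1), of z] U(2) z(1) by blast
    then show ?thesis using U(3)[of z'] unfolding S by blast
  qed
  have "v \<in> (\<lambda>C. transpose B *v x C) ` full_dim_chambers L H"
    if v: "v \<in> vertices PB" and sel: "\<forall>C \<in> full_dim_chambers L H. z C \<in> C \<and>
      is_arg_max (\<lambda>y. z C \<bullet> (transpose B *v y)) (\<lambda>y. y \<in> X) (x C)" for v z x
  proof -
    obtain y where y: "y \<in> ?S" "strict_max_at PB y v" using exposed[OF v] by blast
    define C where "C = connected_component_set ?S y"
    have "closed h" if "h \<in> H" for h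
    proof -
      obtain g where "h = {z \<in> L. z \<bullet> g = 0}" using \<open>h \<in> H\<close> unfolding G(5) by blast
      then have "h = L \<inter> {z. g \<bullet> z = 0}" by (auto simp: inner_commute)
      then show ?thesis using L by (simp add: closed_Int closed_subspace closed_hyperplane)
    qed
    then have C: "C \<in> full_dim_chambers L H"
      unfolding C_def using y(1) L G(1,5)
      by (intro connected_component_in_full_dim_chambers) auto
    have "C \<subseteq> ?S" unfolding C_def by (rule connected_component_subset)
    moreover have "y \<in> C" using connected_component_refl[OF y(1)] unfolding C_def by simp
    moreover have "connected C" unfolding C_def by simp
    \<comment> \<open>The selected direction \<open>z C\<close> may differ from \<open>y\<close>,
      but constancy on the chamber makes \<open>v\<close> its maximiser as well.\<close>
    ultimately have opt: "strict_max_at PB (z C) v"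
      using strict_max_at_connected[OF PB, of C y "z C" v] ex y(2) conjunct1[OF bspec[OF sel C]]
      by (meson subsetD)
    have xC: "x C \<in> X" "\<And>p. p \<in> X \<Longrightarrow> (B *v z C) \<bullet> p \<le> (B *v z C) \<bullet> x C"
      using conjunct2[OF bspec[OF sel C]]
      unfolding is_arg_max_def inner_transpose_vector by (metis not_less)+
    \<comment> \<open>Half-spaces are convex, so optimality of \<open>x C\<close> over
      \<open>X\<close> extends to the hull and then to \<open>PB\<close>. Strictness of the maximum
      at \<open>v\<close> finally identifies the image of \<open>x C\<close> with
      \<open>v\<close>.\<close>
    then have "X \<subseteq> {p. (B *v z C) \<bullet> p \<le> (B *v z C) \<bullet> x C}" by blast
    then have P_le: "P \<subseteq> {p. (B *v z C) \<bullet> p \<le> (B *v z C) \<bullet> x C}"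
      unfolding P_def by (rule hull_minimal) (rule convex_halfspace_le)
    have max: "z C \<bullet> q \<le> z C \<bullet> (transpose B *v x C)" if "q \<in> PB" for q
    proof -
      obtain p where p: "p \<in> P" "q = transpose B *v p"
        using \<open>q \<in> PB\<close> unfolding PB_def proj_image_def by blast
      show ?thesis using P_le p(1) unfolding p(2) inner_transpose_vector by blast
    qed
    have "x C \<in> P" unfolding P_def by (rule hull_inc) (rule xC(1))
    then have "transpose B *v x C \<in> PB" unfolding PB_def proj_image_def by (rule imageI)
    then have "transpose B *v x C = v"
      using opt max[of v] unfolding strict_max_at_def by (meson not_less)
    then show ?thesis using C by blast
  qed
  moreover have "card (vertices PB) \<le> Rc N d"
    using card_strict_max_points_le[OF PB L G(1) S ex exposed] by (simp add: G(4) d_def)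
  ultimately show ?thesis
    using finite_vertices_polytope[OF PB] Rc_bigo by (intro conjI allI impI subsetI) blast+
qed

end
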